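(* Let $P\subset\mathbb{R}^D$ be an $(\epsilon_1,\epsilon_2)$-significant instance of $k$-means clustering with $z$ outliers, $|P|=n$, and let $\eta,\delta,\xi\in(0,1)$. Consider the following algorithm: (1) sample a set $S$ of $\max\{\frac{3k}{\delta^2\epsilon_1}\log\frac{2k}{\eta},\frac{k}{2\xi^2\epsilon_1(1-\delta)}\log\frac{2k}{\eta}\}$ points uniformly at random from $P$; (2) let $k'=\frac{1}{\eta}\frac{\epsilon_2}{k}|S|$ and solve $(k+k')$-means clustering on $S$ using any $c$-approximation algorithm with $c\ge1$; output the set $H$ of $k+k'$ returned centers. Then with probability at least $(1-\eta)^3$, $$\Delta^{-z}_2(P,H)\le\alpha\,\Delta^{-z}_2(P,O^* )+\beta\,\xi\,\mathcal{L}^2,$$ where $\alpha=2+(4+4c)\frac{1+\delta}{1-\delta}$ and $\beta=(4+4c)\frac{1+\delta}{1-\delta}$.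
   Context: For finite $H\subset\mathbb{R}^D$, $dist(p,H)=\min_{q\in H}\|p-q\|$; for integer $0<z<n$, $\Delta^{-z}_2(P,H)=\min\{\frac{1}{|P'|}\sum_{p\in P'}dist(p,H)^2: P'\subset P,|P'|=n-z\}$. The $k$-means clustering with $z$ outliers problem asks for $k$ centers in $\mathbb{R}^D$ minimizing $\Delta^{-z}_2(P,\cdot)$. $P_{opt}\subset P$, $|P_{opt}|=n-z$, is the set of inliers of an optimal solution, and $C^*_1,\dots,C^*_k$ are the optimal clusters forming $P_{opt}$; $o^*_j$ is the mean point of $C^*_j$ and $O^*=\{o^*_1,\dots,o^*_k\}$; $\mathcal{L}=\max_{1\le j\le k}\max_{p,q\in C^*_j}\|p-q\|$. The instance is $(\epsilon_1,\epsilon_2)$-significant ($\epsilon_1,\epsilon_2>0$) if $\min_j|C^*_j|\ge\frac{\epsilon_1}{k}n$ and $z=\frac{\epsilon_2}{k}n$. A $c$-approximation for $m$-means on $S$ returns $m$ centers $H$ with $\sum_{q\in S}dist(q,H)^2$ at most $c$ times the minimum over all sets of $m$ centers in $\mathbb{R}^D$. Sampling uniformly at random means each sample point is drawn independently and uniformly from $P$ ($S$ regarded as a multiset). *)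

theory Defs
  imports "HOL-Analysis.Analysis" "HOL-Probability.Probability"
begin

definition dist_set :: "'a::euclidean_space \<Rightarrow> 'a set \<Rightarrow> real" where
  "dist_set p H = Min ((\<lambda>q. dist p q) ` H)"

definition trimmed_cost :: "'a::euclidean_space set \<Rightarrow> nat \<Rightarrow> 'a set \<Rightarrow> real" where
  "trimmed_cost P z H =
     Min {(\<Sum>p\<in>P'. (dist_set p H)\<^sup>2) / real (card P') | P'. P' \<subseteq> P \<and> card P' = card P - z}"

definition mean_point :: "'a::euclidean_space set \<Rightarrow> 'a" where
  "mean_point C = (1 / real (card C)) *\<^sub>R (\<Sum>p\<in>C. p)"

text \<open>k-means cost of a multiset of points (given as a list) w.r.t. centers H\<close>
definition kmeans_cost :: "'a::euclidean_space list \<Rightarrow> 'a set \<Rightarrow> real" where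
  "kmeans_cost S H = (\<Sum>q\<leftarrow>S. (dist_set q H)\<^sup>2)"

definition is_c_approx :: "real \<Rightarrow> nat \<Rightarrow> 'a::euclidean_space list \<Rightarrow> 'a set \<Rightarrow> bool" where
  "is_c_approx c m S H \<longleftrightarrow> finite H \<and> card H = m \<and>
     kmeans_cost S H \<le> c * (INF H'\<in>{H'. finite H' \<and> card H' = m}. kmeans_cost S H')"

text \<open>All samples of m points drawn independently uniformly from P (as lists)\<close>
definition samples :: "'a set \<Rightarrow> nat \<Rightarrow> 'a list set" where
  "samples P m = {xs. set xs \<subseteq> P \<and> length xs = m}"

definition max_diam :: "nat \<Rightarrow> (nat \<Rightarrow> 'a::euclidean_space set) \<Rightarrow> real" where
  "max_diam k C = Max (\<Union>j<k. {dist p q | p q. p \<in> C j \<and> q \<in> C j})"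

end

theory Submission
  imports Defs
begin

text \<open>
  Three events suffice: every optimal cluster \<open>C j\<close> receives at least \<open>(1 - \<delta>)\<close> times its expected
  number of sample points; the sampled inlier cost is at most \<open>(1 + \<delta>)\<close> times its expectation plus
  the corresponding multiple of \<open>\<xi> L\<^sup>2\<close>; and at most \<open>k'\<close> sample points are outliers. Under the
  last event the means of the clusters together with the sampled outliers are admissible centers
  for the sample, so the cost of \<open>H\<close> on the sample is at most \<open>c\<close> times the sampled inlier cost.
  Averaging the triangle inequality through the sample points of each cluster carries this
  over to all inliers.

  The failure probabilities must add up to at most \<open>1 - (1 - \<eta>)^3\<close>, which tends to 1 with \<open>\<eta>\<close>, so
  Markov's inequality for the outliers is not enough. Two sharpenings close the gap. The number of
  sampled outliers is binomial with mean at most \<open>k'\<close>, hence exceeds \<open>k'\<close> with probability at most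
  1/2. And both cost and cluster sizes are only needed from one side, where the exponential
  moments at parameter \<open>\<delta>\<close> give the tails \<open>(\<eta>/2k)^k\<close> and \<open>(\<eta>/2k)^(3/2)\<close>.
\<close>

subsection \<open>The upper tail of the binomial distribution\<close>

text \<open>At the first negative index \<open>i0\<close>, replacing every weight by
  \<open>w i0\<close> can only increase each term: earlier terms are nonnegative with smaller
  weights, later ones nonpositive with larger weights. So the weighted sum is at most
  \<open>w i0\<close> times the plain one.\<close>

lemma sum_nonneg_of_weighted_sum_nonneg_crossing:
  fixes E w :: "nat \<Rightarrow> real"
  assumes mono: "\<And>i j. i \<le> j \<Longrightarrow> w i \<le> w j" and pos: "\<And>i. w i > 0"
    and crossing: "\<And>i j. E i < 0 \<Longrightarrow> i \<le> j \<Longrightarrow> E j \<le> 0"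
    and weighted: "(\<Sum>i\<le>N. w i * E i) \<ge> 0"
  shows "(\<Sum>i\<le>N. E i) \<ge> 0"
proof (cases "\<exists>i. E i < 0")
  case False
  then show ?thesis by (intro sum_nonneg) (meson not_le)
next
  case True
  define i0 where "i0 = (LEAST i. E i < 0)"
  have i0: "E i0 < 0" unfolding i0_def using True by (metis LeastI_ex)
  have before: "E i \<ge> 0" if "i < i0" for i
    using not_less_Least[OF that[unfolded i0_def]] by simp
  have "w i * E i \<le> w i0 * E i" for i
  proof (cases "i < i0")
    case True
    then show ?thesis using before mono by (intro mult_right_mono) auto
  next
    case False
    then show ?thesis using crossing[OF i0] mono by (intro mult_right_mono_neg) auto
  qed
  then have "(\<Sum>i\<le>N. w i * E i) \<le> w i0 * (\<Sum>i\<le>N. E i)"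
    unfolding sum_distrib_left by (intro sum_mono)
  then show ?thesis using weighted pos[of i0] by (metis order_trans zero_le_mult_iff not_less)
qed

text \<open>The ratio of successive binomial masses, cleared of denominators so that it also holds
  for \<open>i \<ge> n\<close>, where both sides vanish.\<close>

lemma Bernstein_Suc_mult:
  "real (Suc i) * (1 - x) * Bernstein n (Suc i) x = (real n - real i) * x * Bernstein n i x"
proof (cases "i < n")
  case True
  have "real (Suc i) * real (n choose Suc i) = (real n - real i) * real (n choose i)"
  proof -
    have "Suc i * (n choose Suc i) = (n - i) * (n choose i)"
      using binomial_absorb_comp[of n i] binomial_absorption[of i n] by simp
    then show ?thesis using True by (metis of_nat_diff of_nat_mult less_imp_le)
  qed
  moreover have "(1 - x) ^ (n - i) = (1 - x) * (1 - x) ^ (n - Suc i)"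
    using True by (metis Suc_diff_Suc power_Suc)
  ultimately show ?thesis unfolding Bernstein_def by (simp add: mult_ac)
next
  case False
  then show ?thesis by (cases "i = n") (auto simp: Bernstein_def binomial_eq_0)
qed

text \<open>Reflect the binomial distribution at \<open>K + 1/2\<close>. The differences of the masses at
  \<open>K - i\<close> and \<open>K + 1 + i\<close> change sign at most once, from \<open>+\<close> to \<open>-\<close>, because the quotient of
  successive mass ratios is monotone in \<open>i\<close>. Their sum with weights \<open>i + 1/2\<close> is
  \<open>K + 1/2 - m p > 0\<close>, so by the single sign change the unweighted sum is nonnegative too.\<close>
lemma binomial_upper_tail_le_half:
  fixes p :: real
  assumes p: "0 < p" "p < 1" and K: "real m * p \<le> real K"
  shows "(\<Sum>i\<in>{K<..m}. Bernstein m i p) \<le> 1/2"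
proof (cases "K < m")
  case False
  then show ?thesis by simp
next
  case True
  define b where "b i = Bernstein m i p" for i
  have b0: "b i \<ge> 0" for i using p by (simp add: b_def Bernstein_nonneg)
  have bpos: "b i > 0" if "i \<le> m" for i using p that by (simp add: b_def Bernstein_def)
  have bz: "b i = 0" if "i > m" for i using that by (simp add: b_def Bernstein_def)
  \<comment> \<open>\<open>l\<close> runs down from \<open>K\<close> and \<open>u\<close> up from
    \<open>K + 1\<close>. Since \<open>l\<close> is 0 past \<open>K\<close> and \<open>b\<close> is
    0 past \<open>m\<close>, all later sums can run over \<open>i \<le> m\<close>.\<close>
  define l where "l i = (if i \<le> K then b (K - i) else 0)" for i
  define u where "u i = b (K + 1 + i)" for i
  define q where "q = 1 - p"
  have q: "q > 0" using p by (simp add: q_def)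
  define M where "M = real m - real K"
  define K' where "K' = real K + 1"
  have M: "M \<ge> 1" using True unfolding M_def by linarith
  have pM: "p * M \<le> q * real K" using K by (simp add: M_def q_def algebra_simps)
  have pM': "p * M < q * K'" using pM q by (simp add: K'_def algebra_simps)
  have l_pos: "l i > 0" if "i \<le> K" for i using that True bpos by (simp add: l_def)
  have u_nn: "u i \<ge> 0" for i by (simp add: u_def b0)
  have step_b: "real (Suc i) * q * b (Suc i) = (real m - real i) * p * b i" for i
    unfolding b_def q_def using Bernstein_Suc_mult .
  have first: "u 0 \<le> l 0"
  proof -
    have "K' * q * u 0 = p * M * l 0"
      using step_b[of K] by (simp add: u_def l_def K'_def M_def mult_ac add_ac)
    also have "\<dots> \<le> K' * q * l 0"
      using pM' l_pos[of 0] by (intro mult_right_mono) (auto simp: mult_ac)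
    finally show ?thesis using q by (simp add: K'_def)
  qed
  define \<theta> where "\<theta> = (p / q)\<^sup>2"
  have \<theta>M: "\<theta> * M\<^sup>2 \<le> K'\<^sup>2"
  proof -
    have "p / q * M \<le> K'" using pM' q by (simp add: field_simps)
    then have "(p / q * M)\<^sup>2 \<le> K'\<^sup>2" using p q M by (intro power_mono) auto
    then show ?thesis unfolding \<theta>_def power_mult_distrib .
  qed
  \<comment> \<open>\<open>\<rho> (Suc i)\<close> is the factor by which \<open>u / l\<close>
    changes from \<open>i\<close> to \<open>Suc i\<close>; \<open>ratio\<close> states this without
    division.\<close>
  define \<rho> where "\<rho> i = \<theta> * (M\<^sup>2 - (real i)\<^sup>2) / (K'\<^sup>2 - (real i)\<^sup>2)" for i
  have den: "K'\<^sup>2 - (real i)\<^sup>2 > 0" if "i \<le> K" for i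
    using that by (simp add: K'_def power_strict_mono)
  have ratio: "u (Suc i) * l i = \<rho> (Suc i) * u i * l (Suc i)" if i: "Suc i \<le> K" for i
  proof -
    define s where "s = real (Suc i)"
    have 1: "(K' + s) * q * u (Suc i) = (M - s) * p * u i"
      using step_b[of "K + 1 + i"] by (simp add: u_def K'_def M_def s_def algebra_simps)
    have 2: "(K' - s) * q * l i = (M + s) * p * l (Suc i)"
    proof -
      have e: "Suc (K - Suc i) = K - i" using i by simp
      show ?thesis using step_b[of "K - Suc i"] i unfolding e
        by (simp add: l_def K'_def M_def s_def algebra_simps of_nat_diff)
    qed
    have "((K' + s) * q * u (Suc i)) * ((K' - s) * q * l i)
        = ((M - s) * p * u i) * ((M + s) * p * l (Suc i))" unfolding 1 2 by simp
    then have *: "(K'\<^sup>2 - s\<^sup>2) * q\<^sup>2 * (u (Suc i) * l i) = (M\<^sup>2 - s\<^sup>2) * p\<^sup>2 * (u i * l (Suc i))"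
      by (simp add: algebra_simps power2_eq_square)
    have d: "K'\<^sup>2 - s\<^sup>2 > 0" using den[OF i] by (simp add: s_def)
    show ?thesis unfolding \<rho>_def \<theta>_def s_def[symmetric] using * d q
      by (simp add: field_simps power_divide)
  qed
  \<comment> \<open>For \<open>x \<le> K\<close>, \<open>\<rho> x > 1\<close> is a condition linear
    in x^2 whose right-hand side is nonpositive by \<open>\<theta>M\<close>. It can hold only if
    \<theta> < 1, and then it persists for larger x.\<close>
  have \<rho>_up: "\<rho> j > 1" if "\<rho> i > 1" "i \<le> j" "j \<le> K" for i j
  proof -
    have e: "\<rho> x > 1 \<longleftrightarrow> (\<theta> - 1) * (real x)\<^sup>2 < \<theta> * M\<^sup>2 - K'\<^sup>2" if "x \<le> K" for x
      using den[OF that] by (auto simp: \<rho>_def field_simps)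
    have 1: "(\<theta> - 1) * (real i)\<^sup>2 < \<theta> * M\<^sup>2 - K'\<^sup>2" using e[of i] that by simp
    then have "(\<theta> - 1) * (real i)\<^sup>2 < 0" using \<theta>M by linarith
    then have "\<theta> < 1" by (simp add: mult_less_0_iff)
    then have "(\<theta> - 1) * (real j)\<^sup>2 \<le> (\<theta> - 1) * (real i)\<^sup>2"
      using that by (intro mult_left_mono_neg power_mono) auto
    then show ?thesis using e[of j] 1 that by simp
  qed
  \<comment> \<open>By \<open>first\<close> the quotient \<open>u / l\<close> starts at 1 or below,
    so it exceeds 1 only after some factor \<rho> has exceeded 1.\<close>
  have \<rho>_ex: "\<exists>x\<le>i. \<rho> x > 1" if "l i < u i" "i \<le> K" for i
    using that
  proof (induction i)
    case 0
    then show ?case using first by simp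
  next
    case (Suc i)
    show ?case
    proof (cases "l i < u i")
      case True
      then show ?thesis using Suc by (meson Suc_leD le_SucI)
    next
      case False
      have "\<rho> (Suc i) > 1"
      proof (rule ccontr)
        assume "\<not> \<rho> (Suc i) > 1"
        then have "\<rho> (Suc i) * (u i * l (Suc i)) \<le> 1 * (u i * l (Suc i))"
          using u_nn l_pos[OF Suc.prems(2)] by (intro mult_right_mono) auto
        also have "\<dots> \<le> l i * l (Suc i)" using False l_pos[OF Suc.prems(2)] by simp
        finally have "u (Suc i) * l i \<le> l (Suc i) * l i"
          using ratio[OF Suc.prems(2)] by (simp add: mult_ac)
        then show False using Suc.prems l_pos[of i] by simp
      qed
      then show ?thesis by blast
    qed
  qed
  \<comment> \<open>From that factor on, \<open>\<rho>_up\<close> keeps all factors above 1, so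
    \<open>u / l\<close> goes on growing up to index \<open>K\<close>.\<close>
  have cross_step: "l (Suc i) < u (Suc i)" if lu: "l i < u i" and iK: "Suc i \<le> K" for i
  proof -
    obtain x where x: "x \<le> i" "\<rho> x > 1" using \<rho>_ex[OF lu] iK by auto
    have r: "\<rho> (Suc i) > 1" using \<rho>_up[OF x(2), of "Suc i"] x lu iK by simp
    have ui: "u i > 0" using lu iK l_pos[of i] by simp
    have "l i * l (Suc i) < u i * l (Suc i)" using lu iK l_pos[of "Suc i"] by simp
    also have "\<dots> < \<rho> (Suc i) * (u i * l (Suc i))" using r ui l_pos[OF iK] by simp
    finally have "l (Suc i) * l i < u (Suc i) * l i"
      using ratio[OF iK] by (simp add: mult_ac)
    then show ?thesis using l_pos[of i] lu iK by simp
  qed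
  have cross: "l j - u j \<le> 0" if "l i - u i < 0" "i \<le> j" for i j
  proof (cases "j \<le> K")
    case False
    then show ?thesis using u_nn by (simp add: l_def)
  next
    case True
    have "l j < u j" using \<open>i \<le> j\<close> True
    proof (induction j rule: dec_induct)
      case base
      then show ?case using that by simp
    next
      case (step n)
      then show ?case using cross_step by simp
    qed
    then show ?thesis by simp
  qed
  have split: "(\<Sum>i\<le>m. f i * b i) = (\<Sum>i\<le>m. (if i \<le> K then f (K - i) else 0) * l i) + (\<Sum>i\<le>m. f (K + 1 + i) * u i)"
    for f :: "nat \<Rightarrow> real"
  proof -
    have "(\<Sum>i\<le>m. f i * b i) = (\<Sum>i\<le>K. f i * b i) + (\<Sum>i\<in>{K<..m}. f i * b i)"
      using True by (subst sum.union_disjoint[symmetric]) (auto intro!: sum.cong)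
    also have "(\<Sum>i\<le>K. f i * b i) = (\<Sum>i\<le>K. f (K - i) * b (K - i))"
      by (rule sum.reindex_bij_witness[of _ "\<lambda>i. K - i" "\<lambda>i. K - i"]) auto
    also have "\<dots> = (\<Sum>i\<le>m. (if i \<le> K then f (K - i) else 0) * l i)"
      using True by (intro sum.mono_neutral_cong_left) (auto simp: l_def)
    also have "(\<Sum>i\<in>{K<..m}. f i * b i) = (\<Sum>i<m-K. f (K + 1 + i) * u i)"
      unfolding u_def by (rule sum.reindex_bij_witness[of _ "\<lambda>i. K + 1 + i" "\<lambda>i. i - K - 1"]) auto
    also have "\<dots> = (\<Sum>i\<le>m. f (K + 1 + i) * u i)"
      using bz by (intro sum.mono_neutral_cong_left) (auto simp: u_def)
    finally show ?thesis .
  qed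
  have total: "(\<Sum>i\<le>m. b i) = 1" by (simp add: b_def sum_Bernstein)
  have mean: "(\<Sum>i\<le>m. real i * b i) = real m * p" by (simp add: b_def sum_k_Bernstein)
  \<comment> \<open>The signed distance from \<open>K + 1/2\<close> is \<open>i + 1/2\<close> at the
    index \<open>K - i\<close> and \<open>- (i + 1/2)\<close> at \<open>K + 1 + i\<close>.\<close>
  have "(\<Sum>i\<le>m. (real i + 1/2) * (l i - u i)) = (\<Sum>i\<le>m. (real K + 1/2 - real i) * b i)"
    unfolding split[of "\<lambda>i. real K + 1/2 - real i"] sum.distrib[symmetric]
    by (intro sum.cong) (auto simp: l_def algebra_simps of_nat_diff)
  also have "\<dots> = real K + 1/2 - real m * p"
    using total mean by (simp add: algebra_simps sum.distrib sum_subtractf sum_distrib_left[symmetric] sum_divide_distrib[symmetric])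
  finally have "(\<Sum>i\<le>m. (real i + 1/2) * (l i - u i)) \<ge> 0" using K by simp
  then have "(\<Sum>i\<le>m. l i - u i) \<ge> 0"
    by (intro sum_nonneg_of_weighted_sum_nonneg_crossing[where w="\<lambda>i. real i + 1/2" and E="\<lambda>i. l i - u i"] cross) auto
  moreover have "(\<Sum>i\<le>m. l i) + (\<Sum>i\<le>m. u i) = 1"
  proof -
    have "(\<Sum>i\<le>m. (if i \<le> K then 1 else 0) * l i) = (\<Sum>i\<le>m. l i)"
      by (intro sum.cong) (auto simp: l_def)
    then show ?thesis using split[of "\<lambda>_. 1"] total by simp
  qed
  moreover have "(\<Sum>i\<in>{K<..m}. b i) = (\<Sum>i\<le>m. u i)"
  proof -
    have "(\<Sum>i\<in>{K<..m}. b i) = (\<Sum>i\<le>m. (if K < i then 1 else 0) * b i)"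
      by (rule sum.mono_neutral_cong_left) auto
    also have "\<dots> = (\<Sum>i\<le>m. u i)"
      unfolding split[of "\<lambda>i. if K < i then 1 else 0"]
      by (subst sum.neutral) auto
    finally show ?thesis .
  qed
  ultimately show ?thesis by (simp add: b_def sum_subtractf)
qed

text \<open>Markov's inequality, which beats the bound 1/2 when \<eta> is small; the two are
  combined as \<open>min \<eta> (1/2)\<close>.\<close>

lemma binomial_upper_tail_Markov:
  fixes p \<eta> :: real
  assumes p: "0 < p" "p < 1" and \<eta>: "0 < \<eta>" and m: "m > 0" and K: "real m * p / \<eta> \<le> real K"
  shows "(\<Sum>i\<in>{K<..m}. Bernstein m i p) \<le> \<eta>"
proof -
  have b0: "Bernstein m i p \<ge> 0" for i using p by (simp add: Bernstein_nonneg)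
  have pos: "real m * p / \<eta> > 0" using m p \<eta> by simp
  have "(real m * p / \<eta>) * (\<Sum>i\<in>{K<..m}. Bernstein m i p) \<le> (\<Sum>i\<in>{K<..m}. real i * Bernstein m i p)"
    unfolding sum_distrib_left using K b0 by (intro sum_mono mult_right_mono) auto
  also have "\<dots> \<le> (\<Sum>i\<le>m. real i * Bernstein m i p)"
    using b0 by (intro sum_mono2) auto
  also have "\<dots> = (real m * p / \<eta>) * \<eta>" using \<eta> by (simp add: sum_k_Bernstein)
  finally show ?thesis using pos by (metis mult_le_cancel_left_pos)
qed

subsection \<open>Tail bounds for uniform samples\<close>

lemma samples_0: "samples P 0 = {[]}"
  by (auto simp: samples_def)

lemma samples_Suc: "samples P (Suc m) = (\<lambda>(x, xs). x # xs) ` (P \<times> samples P m)"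
  by (auto simp: samples_def length_Suc_conv image_iff)

lemma finite_samples: "finite P \<Longrightarrow> finite (samples P m)"
  unfolding samples_def by (rule finite_lists_length_eq)

lemma card_samples: "finite P \<Longrightarrow> card (samples P m) = card P ^ m"
  unfolding samples_def by (rule card_lists_length_eq)

lemma sum_samples_Suc:
  assumes "finite P"
  shows "(\<Sum>xs\<in>samples P (Suc m). F xs) = (\<Sum>x\<in>P. \<Sum>xs\<in>samples P m. F (x # xs))"
  unfolding samples_Suc
  by (subst sum.reindex) (auto simp: inj_on_def sum.cartesian_product intro!: sum.cong)

text \<open>Independence of the draws in counting form. Applied to exponentials it gives the moment
  generating function of a sample sum.\<close>

lemma sum_samples_prod_list:
  fixes f :: "'a \<Rightarrow> real"
  assumes "finite P"
  shows "(\<Sum>xs\<in>samples P m. \<Prod>x\<leftarrow>xs. f x) = (\<Sum>x\<in>P. f x) ^ m"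
  by (induction m)
    (simp_all add: samples_0 sum_samples_Suc[OF assms] sum_distrib_left[symmetric] sum_distrib_right)

lemma exp_sum_list: "exp (\<Sum>x\<leftarrow>xs. f x :: real) = (\<Prod>x\<leftarrow>xs. exp (f x))"
  by (induction xs) (auto simp: exp_add)

text \<open>The indicator of the event is at most the exponential of the excess over
  \<open>t\<close>, whose sum over all samples factorises. Samples are counted, so the tail bounds
  below carry a factor \<open>card P ^ m\<close>.\<close>

lemma card_samples_Chernoff:
  fixes f :: "'a \<Rightarrow> real"
  assumes P: "finite P"
  shows "real (card {xs \<in> samples P m. t \<le> (\<Sum>x\<leftarrow>xs. f x)}) \<le> exp (- t) * (\<Sum>x\<in>P. exp (f x)) ^ m"
proof -
  have fin: "finite (samples P m)" using P by (rule finite_samples)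
  have "real (card {xs \<in> samples P m. t \<le> (\<Sum>x\<leftarrow>xs. f x)})
      = (\<Sum>xs\<in>{xs \<in> samples P m. t \<le> (\<Sum>x\<leftarrow>xs. f x)}. 1)" by simp
  also have "\<dots> \<le> (\<Sum>xs\<in>{xs \<in> samples P m. t \<le> (\<Sum>x\<leftarrow>xs. f x)}. exp ((\<Sum>x\<leftarrow>xs. f x) - t))"
    by (intro sum_mono) auto
  also have "\<dots> \<le> (\<Sum>xs\<in>samples P m. exp ((\<Sum>x\<leftarrow>xs. f x) - t))"
    using fin by (intro sum_mono2) auto
  also have "\<dots> = exp (- t) * (\<Sum>xs\<in>samples P m. \<Prod>x\<leftarrow>xs. exp (f x))"
    by (simp add: exp_diff exp_minus exp_sum_list sum_distrib_left divide_inverse mult_ac)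
  finally show ?thesis by (simp add: sum_samples_prod_list[OF P])
qed

text \<open>From 1 + x <= exp x. In the tail bounds \<open>n\<close> is the population size and
  \<open>n + y\<close> bounds the exponential moment summed over \<open>P\<close>.\<close>

lemma power_one_plus_le_exp:
  fixes n y :: real
  assumes "n > 0" "0 \<le> n + y"
  shows "(n + y) ^ m \<le> n ^ m * exp (real m / n * y)"
proof -
  have "n + y = n * (1 + y / n)" using assms by (simp add: field_simps)
  also have "\<dots> \<le> n * exp (y / n)" using assms by (intro mult_left_mono exp_ge_add_one_self) auto
  finally have "(n + y) ^ m \<le> (n * exp (y / n)) ^ m" using assms by (intro power_mono) auto
  also have "\<dots> = n ^ m * exp (real m / n * y)"
    by (simp add: power_mult_distrib exp_of_nat_mult[symmetric] mult_ac)
  finally show ?thesis .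
qed

text \<open>The difference vanishes at 0 and has the nonnegative derivative
  \<open>- 1 + y + exp (- y)\<close>. The coefficient 1/2 produces the exponent of the lower
  tail.\<close>

lemma exp_minus_le_quadratic:
  fixes x :: real
  assumes "0 \<le> x"
  shows "exp (- x) \<le> 1 - x + x\<^sup>2 / 2"
proof -
  define F where "F x = 1 - x + x\<^sup>2 / 2 - exp (- x)" for x :: real
  have "F 0 \<le> F x"
  proof (rule DERIV_nonneg_imp_nondecreasing[OF assms])
    fix y :: real
    assume "0 \<le> y" "y \<le> x"
    have "(F has_real_derivative (- 1 + y + exp (- y))) (at y)"
      unfolding F_def by (auto intro!: derivative_eq_intros)
    moreover have "- 1 + y + exp (- y) \<ge> 0" using exp_ge_add_one_self[of "- y"] by simp
    ultimately show "\<exists>d. (F has_real_derivative d) (at y) \<and> 0 \<le> d" by blast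
  qed
  then show ?thesis by (simp add: F_def)
qed

text \<open>Chernoff with parameter -\<delta>: the exponent \<delta>(1 - \<delta>)\<mu> +
  \<mu>(exp(-\<delta>) - 1) is bounded by the quadratic estimate of exp(-\<delta>).\<close>

lemma card_samples_lower_tail:
  fixes \<delta> :: real and m :: nat
  assumes P: "finite P" "P \<noteq> {}" and B: "B \<subseteq> P" and \<delta>: "0 < \<delta>" "\<delta> < 1"
  defines "\<mu> \<equiv> real m / real (card P) * real (card B)"
  shows "real (card {xs \<in> samples P m. (\<Sum>x\<leftarrow>xs. indicat_real B x) < (1 - \<delta>) * \<mu>})
    \<le> real (card P) ^ m * exp (- (\<delta>\<^sup>2 * \<mu> / 2))"
proof -
  define n where "n = real (card P)"
  have n: "n > 0" using P by (simp add: n_def card_gt_0_iff)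
  have scale: "(\<Sum>x\<leftarrow>xs. - \<delta> * indicat_real B x) = - \<delta> * (\<Sum>x\<leftarrow>xs. indicat_real B x)" for xs
    by (induction xs) (auto simp: algebra_simps)
  have "{xs \<in> samples P m. (\<Sum>x\<leftarrow>xs. indicat_real B x) < (1 - \<delta>) * \<mu>}
      \<subseteq> {xs \<in> samples P m. - \<delta> * ((1 - \<delta>) * \<mu>) \<le> (\<Sum>x\<leftarrow>xs. - \<delta> * indicat_real B x)}"
    unfolding scale using \<delta> by (auto intro!: mult_left_mono)
  then have "real (card {xs \<in> samples P m. (\<Sum>x\<leftarrow>xs. indicat_real B x) < (1 - \<delta>) * \<mu>})
     \<le> real (card {xs \<in> samples P m. - \<delta> * ((1 - \<delta>) * \<mu>) \<le> (\<Sum>x\<leftarrow>xs. - \<delta> * indicat_real B x)})"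
    using finite_samples[OF P(1), of m] by (intro of_nat_mono card_mono) simp_all
  also have "\<dots> \<le> exp (\<delta> * ((1 - \<delta>) * \<mu>)) * (\<Sum>x\<in>P. exp (- \<delta> * indicat_real B x)) ^ m"
    using card_samples_Chernoff[OF P(1), of m "- \<delta> * ((1 - \<delta>) * \<mu>)"] by simp
  also have "(\<Sum>x\<in>P. exp (- \<delta> * indicat_real B x)) = n + real (card B) * (exp (- \<delta>) - 1)"
  proof -
    have "(\<Sum>x\<in>P. exp (- \<delta> * indicat_real B x)) = (\<Sum>x\<in>P. 1 + indicat_real B x * (exp (- \<delta>) - 1))"
      by (intro sum.cong) (auto simp: indicator_def)
    also have "\<dots> = n + (\<Sum>x\<in>P. indicat_real B x) * (exp (- \<delta>) - 1)"
      by (simp add: sum.distrib sum_distrib_right n_def)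
    also have "(\<Sum>x\<in>P. indicat_real B x) = real (card B)"
      unfolding card_eq_sum of_nat_sum using P B by (intro sum.mono_neutral_cong_right) auto
    finally show ?thesis .
  qed
  also have "(n + real (card B) * (exp (- \<delta>) - 1)) ^ m
      \<le> n ^ m * exp (real m / n * (real (card B) * (exp (- \<delta>) - 1)))"
  proof (rule power_one_plus_le_exp[OF n])
    have "real (card B) * (1 - exp (- \<delta>)) \<le> n * 1"
      using \<delta> P B by (intro mult_mono) (auto simp: n_def card_mono)
    then show "0 \<le> n + real (card B) * (exp (- \<delta>) - 1)" by (simp add: algebra_simps)
  qed
  also have "exp (\<delta> * ((1 - \<delta>) * \<mu>)) * (n ^ m * exp (real m / n * (real (card B) * (exp (- \<delta>) - 1))))
      = n ^ m * exp (\<delta> * ((1 - \<delta>) * \<mu>) + \<mu> * (exp (- \<delta>) - 1))"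
    by (simp add: exp_add \<mu>_def n_def mult_ac)
  also have "\<dots> \<le> n ^ m * exp (- (\<delta>\<^sup>2 * \<mu> / 2))"
  proof -
    have "\<mu> \<ge> 0" by (simp add: \<mu>_def)
    then have "\<mu> * (exp (- \<delta>) - 1) \<le> \<mu> * (- \<delta> + \<delta>\<^sup>2 / 2)"
      using exp_minus_le_quadratic[of \<delta>] \<delta> by (intro mult_left_mono) auto
    then have "\<delta> * ((1 - \<delta>) * \<mu>) + \<mu> * (exp (- \<delta>) - 1) \<le> - (\<delta>\<^sup>2 * \<mu> / 2)"
      by (simp add: algebra_simps power2_eq_square)
    then show ?thesis using n by simp
  qed
  finally show ?thesis by (simp add: n_def)
qed

text \<open>Chernoff with parameter \<delta>/R. For y in [0,1], exp(\<delta> y) <= 1 + (\<delta> +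
  \<delta>^2) y, so the moment contributes (\<delta> + \<delta>^2)\<mu> to the exponent. The
  multiplicative part of the threshold cancels this exactly, and only the slack \<open>t\<close>
  remains.\<close>

lemma card_samples_upper_tail:
  fixes \<delta> t R :: real
  assumes P: "finite P" "P \<noteq> {}" and \<delta>: "0 < \<delta>" "\<delta> < 1"
    and R: "0 \<le> R" and g: "\<And>x. x \<in> P \<Longrightarrow> 0 \<le> g x \<and> g x \<le> R"
  shows "real (card {xs \<in> samples P m.
      (1 + \<delta>) * (real m / real (card P) * (\<Sum>x\<in>P. g x)) + R * t < (\<Sum>x\<leftarrow>xs. g x)})
    \<le> real (card P) ^ m * exp (- (\<delta> * t))"
proof (cases "R = 0")
  case True
  \<comment> \<open>Scaling by 1/R is impossible here, but \<open>g\<close> vanishes on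
    \<open>P\<close>, so the strict inequality fails for every sample.\<close>
  then have "g x = 0" if "x \<in> P" for x using g[OF that] by simp
  then have "(\<Sum>x\<in>P. g x) = 0" and "(\<Sum>x\<leftarrow>xs. g x) = 0" if "xs \<in> samples P m" for xs
    using that by (auto simp: samples_def subset_iff cong: map_cong)
  then have e: "{xs \<in> samples P m.
      (1 + \<delta>) * (real m / real (card P) * (\<Sum>x\<in>P. g x)) + R * t < (\<Sum>x\<leftarrow>xs. g x)} = {}"
    using True by auto
  show ?thesis unfolding e by simp
next
  case False
  then have R: "R > 0" using R by simp
  define n where "n = real (card P)"
  have n: "n > 0" using P by (simp add: n_def card_gt_0_iff)
  define G where "G = (\<Sum>x\<in>P. g x) / R"
  define \<mu> where "\<mu> = real m / n * G"
  have G0: "G \<ge> 0" using g R unfolding G_def by (auto intro!: sum_nonneg divide_nonneg_nonneg)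
  have \<mu>: "\<mu> \<ge> 0" using G0 n by (simp add: \<mu>_def)
  define s where "s = \<delta> / R"
  have s: "s > 0" using \<delta> R by (simp add: s_def)
  have scale: "(\<Sum>x\<leftarrow>xs. s * g x) = s * (\<Sum>x\<leftarrow>xs. g x)" for xs
    by (induction xs) (auto simp: algebra_simps)
  have T: "s * ((1 + \<delta>) * (real m / n * (\<Sum>x\<in>P. g x)) + R * t) = \<delta> * ((1 + \<delta>) * \<mu> + t)"
    using R n by (simp add: s_def \<mu>_def G_def field_simps)
  have "{xs \<in> samples P m. (1 + \<delta>) * (real m / n * (\<Sum>x\<in>P. g x)) + R * t < (\<Sum>x\<leftarrow>xs. g x)}
      \<subseteq> {xs \<in> samples P m. \<delta> * ((1 + \<delta>) * \<mu> + t) \<le> (\<Sum>x\<leftarrow>xs. s * g x)}"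
    unfolding scale T[symmetric] using s by (auto intro!: mult_left_mono)
  then have "real (card {xs \<in> samples P m. (1 + \<delta>) * (real m / n * (\<Sum>x\<in>P. g x)) + R * t < (\<Sum>x\<leftarrow>xs. g x)})
     \<le> real (card {xs \<in> samples P m. \<delta> * ((1 + \<delta>) * \<mu> + t) \<le> (\<Sum>x\<leftarrow>xs. s * g x)})"
    using finite_samples[OF P(1), of m] by (intro of_nat_mono card_mono) simp_all
  also have "\<dots> \<le> exp (- (\<delta> * ((1 + \<delta>) * \<mu> + t))) * (\<Sum>x\<in>P. exp (s * g x)) ^ m"
    by (rule card_samples_Chernoff[OF P(1)])
  also have "(\<Sum>x\<in>P. exp (s * g x)) ^ m \<le> (n + (\<delta> + \<delta>\<^sup>2) * G) ^ m"
  proof (rule power_mono)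
    have "exp (s * g x) \<le> 1 + (\<delta> + \<delta>\<^sup>2) * (g x / R)" if "x \<in> P" for x
    proof -
      define y where "y = g x / R"
      have y: "0 \<le> y" "y \<le> 1" using g[OF that] R by (auto simp: y_def)
      have sy: "s * g x = \<delta> * y" by (simp add: s_def y_def)
      have "exp (\<delta> * y) \<le> 1 + \<delta> * y + (\<delta> * y)\<^sup>2"
        using y \<delta> by (intro exp_bound) (auto intro: mult_le_one)
      also have "(\<delta> * y)\<^sup>2 \<le> \<delta>\<^sup>2 * y"
        using y \<delta> unfolding power_mult_distrib
        by (intro mult_left_mono) (auto simp: power2_eq_square mult_left_le)
      finally show ?thesis unfolding sy by (simp add: y_def algebra_simps)
    qed
    then have "(\<Sum>x\<in>P. exp (s * g x)) \<le> (\<Sum>x\<in>P. 1 + (\<delta> + \<delta>\<^sup>2) * (g x / R))"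
      by (intro sum_mono)
    also have "\<dots> = n + (\<delta> + \<delta>\<^sup>2) * G"
      by (simp add: sum.distrib n_def G_def sum_distrib_left[symmetric] sum_divide_distrib[symmetric])
    finally show "(\<Sum>x\<in>P. exp (s * g x)) \<le> n + (\<delta> + \<delta>\<^sup>2) * G" .
  qed (auto intro: sum_nonneg)
  also have "(n + (\<delta> + \<delta>\<^sup>2) * G) ^ m \<le> n ^ m * exp (real m / n * ((\<delta> + \<delta>\<^sup>2) * G))"
    using n \<delta> G0 by (intro power_one_plus_le_exp) auto
  also have "exp (- (\<delta> * ((1 + \<delta>) * \<mu> + t))) * (n ^ m * exp (real m / n * ((\<delta> + \<delta>\<^sup>2) * G)))
      = n ^ m * exp (- (\<delta> * ((1 + \<delta>) * \<mu> + t)) + (\<delta> + \<delta>\<^sup>2) * \<mu>)"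
    by (simp only: exp_add \<mu>_def mult_ac)
  also have "- (\<delta> * ((1 + \<delta>) * \<mu> + t)) + (\<delta> + \<delta>\<^sup>2) * \<mu> = - (\<delta> * t)"
    by (simp add: algebra_simps power2_eq_square)
  finally show ?thesis by (simp add: n_def)
qed

section \<open>The exact distribution of the number of sample points in a subset\<close>

lemma card_samples_count:
  assumes P: "finite P" and B: "B \<subseteq> P"
  shows "card {xs \<in> samples P m. length (filter (\<lambda>x. x \<in> B) xs) = i}
    = (m choose i) * card B ^ i * card (P - B) ^ (m - i)"
proof -
  have "(\<Sum>xs\<in>samples P m. if length (filter (\<lambda>x. x \<in> B) xs) = i then 1 else (0::nat))
    = (m choose i) * card B ^ i * card (P - B) ^ (m - i)"
  proof (induction m arbitrary: i)
    case 0
    then show ?case by (cases i) (auto simp: samples_0)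
  next
    case (Suc m)
    let ?N = "\<lambda>m i. \<Sum>xs\<in>samples P m. if length (filter (\<lambda>x. x \<in> B) xs) = i then 1 else (0::nat)"
    have "?N (Suc m) i = (\<Sum>x\<in>P. \<Sum>xs\<in>samples P m.
        if length (filter (\<lambda>x. x \<in> B) (x # xs)) = i then 1 else 0)"
      by (rule sum_samples_Suc[OF P])
    \<comment> \<open>Whether the first entry lies in \<open>B\<close> gives the two summands of
      Pascal's rule.\<close>
    also have "\<dots> = (\<Sum>x\<in>B. \<Sum>xs\<in>samples P m. if length (filter (\<lambda>x. x \<in> B) (x # xs)) = i then 1 else 0)
        + (\<Sum>x\<in>P - B. \<Sum>xs\<in>samples P m. if length (filter (\<lambda>x. x \<in> B) (x # xs)) = i then 1 else 0)"
      using P B by (metis (no_types, lifting) add.commute sum.subset_diff)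
    also have "(\<Sum>x\<in>P - B. \<Sum>xs\<in>samples P m. if length (filter (\<lambda>x. x \<in> B) (x # xs)) = i then 1 else 0)
        = card (P - B) * ?N m i"
      by simp
    also have "(\<Sum>x\<in>B. \<Sum>xs\<in>samples P m. if length (filter (\<lambda>x. x \<in> B) (x # xs)) = i then 1 else 0)
        = card B * (\<Sum>xs\<in>samples P m. if Suc (length (filter (\<lambda>x. x \<in> B) xs)) = i then 1 else 0)"
      by simp
    finally have eq: "?N (Suc m) i = card B * (\<Sum>xs\<in>samples P m. if Suc (length (filter (\<lambda>x. x \<in> B) xs)) = i then 1 else 0)
        + card (P - B) * ?N m i" .
    show ?case
    proof (cases i)
      case 0
      then show ?thesis unfolding eq using Suc.IH[of 0] by simp
    next
      case (Suc j)
      have "card B * ?N m j + card (P - B) * ?N m (Suc j)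
        = (Suc m choose Suc j) * card B ^ Suc j * card (P - B) ^ (Suc m - Suc j)"
      \<comment> \<open>The truncated exponent \<open>m - j\<close> drops by one only for
        \<open>j < m\<close>; otherwise \<open>m choose Suc j\<close> is 0.\<close>
      proof (cases "j < m")
        case True
        then have "card (P - B) ^ (m - j) = card (P - B) * card (P - B) ^ (m - Suc j)"
          by (metis Suc_diff_Suc power_Suc)
        then show ?thesis unfolding Suc.IH by (simp add: algebra_simps)
      next
        case False
        then show ?thesis unfolding Suc.IH by (simp add: binomial_eq_0)
      qed
      then show ?thesis unfolding eq unfolding Suc by simp
    qed
  qed
  then show ?thesis
    using finite_samples[OF P] by (simp add: sum.If_cases Int_def)
qed

lemma card_samples_count_tail:
  assumes P: "finite P" "P \<noteq> {}" and B: "B \<subseteq> P"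
  shows "real (card {xs \<in> samples P m. K < length (filter (\<lambda>x. x \<in> B) xs)})
    = real (card P) ^ m * (\<Sum>i\<in>{K<..m}. Bernstein m i (real (card B) / real (card P)))"
proof -
  define n where "n = real (card P)"
  have n: "n > 0" using P by (simp add: n_def card_gt_0_iff)
  have PB: "real (card (P - B)) = n - real (card B)"
    using P B by (simp add: n_def card_Diff_subset card_mono finite_subset of_nat_diff)
  have "{xs \<in> samples P m. K < length (filter (\<lambda>x. x \<in> B) xs)}
      = (\<Union>i\<in>{K<..m}. {xs \<in> samples P m. length (filter (\<lambda>x. x \<in> B) xs) = i})"
    by (auto simp: samples_def)
  then have "card {xs \<in> samples P m. K < length (filter (\<lambda>x. x \<in> B) xs)}
      = (\<Sum>i\<in>{K<..m}. card {xs \<in> samples P m. length (filter (\<lambda>x. x \<in> B) xs) = i})"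
    using finite_samples[OF P(1), of m] by (simp, subst card_UN_disjoint) auto
  also have "\<dots> = (\<Sum>i\<in>{K<..m}. (m choose i) * card B ^ i * card (P - B) ^ (m - i))"
    by (simp add: card_samples_count[OF P(1) B])
  finally have "real (card {xs \<in> samples P m. K < length (filter (\<lambda>x. x \<in> B) xs)})
      = (\<Sum>i\<in>{K<..m}. real (m choose i) * real (card B) ^ i * (n - real (card B)) ^ (m - i))"
    by (simp add: PB)
  also have "\<dots> = (\<Sum>i\<in>{K<..m}. n ^ m * Bernstein m i (real (card B) / n))"
  proof (rule sum.cong[OF refl])
    fix i assume i: "i \<in> {K<..m}"
    have "1 - real (card B) / n = (n - real (card B)) / n" using n by (simp add: field_simps)
    moreover have "n ^ m = n ^ i * n ^ (m - i)" using i by (simp flip: power_add)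
    ultimately show "real (m choose i) * real (card B) ^ i * (n - real (card B)) ^ (m - i)
        = n ^ m * Bernstein m i (real (card B) / n)"
      using n by (simp add: Bernstein_def power_divide)
  qed
  finally show ?thesis by (simp add: sum_distrib_left n_def)
qed

text \<open>The algorithm's own randomness costs nothing: from a good sample every possible output
  lies in \<open>E\<close>, so the inner probability is 1.\<close>

lemma prob_bind_pmf_ge:
  assumes "\<And>x y. x \<in> set_pmf M \<Longrightarrow> x \<in> G \<Longrightarrow> y \<in> set_pmf (A x) \<Longrightarrow> y \<in> E"
  shows "measure_pmf.prob M G \<le> measure_pmf.prob (bind_pmf M A) E"
proof -
  have "emeasure (measure_pmf M) G = (\<integral>\<^sup>+x. indicator G x \<partial>measure_pmf M)" by simp
  also have "\<dots> \<le> (\<integral>\<^sup>+x. emeasure (measure_pmf (A x)) E \<partial>measure_pmf M)"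
  proof (rule nn_integral_mono_AE, unfold AE_measure_pmf_iff, intro ballI)
    fix x assume x: "x \<in> set_pmf M"
    show "indicator G x \<le> emeasure (measure_pmf (A x)) E"
    proof (cases "x \<in> G")
      case True
      then have "emeasure (measure_pmf (A x)) E = 1"
        using assms[OF x True] by (intro measure_pmf.emeasure_eq_1_AE) (auto simp: AE_measure_pmf_iff)
      then show ?thesis by (simp add: indicator_def)
    qed simp
  qed
  also have "\<dots> = emeasure (measure_pmf (bind_pmf M A)) E" by simp
  finally show ?thesis by (simp add: measure_pmf.emeasure_eq_measure)
qed

text \<open>The first bound serves \<open>k = 1\<close>, the second \<open>k \<ge> 2\<close>. The
  case split at 1/2 is where the minimum changes branch.\<close>

lemma failure_budget_le:
  fixes \<eta> :: real
  assumes "0 < \<eta>" "\<eta> < 1"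
  shows "\<eta> / 2 + min \<eta> (1/2) \<le> 1 - (1 - \<eta>) ^ 3"
    and "\<eta> / 4 + \<eta>\<^sup>2 / 16 + min \<eta> (1/2) \<le> 1 - (1 - \<eta>) ^ 3"
proof -
  have cube: "1 - (1 - \<eta>) ^ 3 = \<eta> * (3 - 3 * \<eta> + \<eta>\<^sup>2)"
    by (simp add: power3_eq_cube power2_eq_square algebra_simps)
  show "\<eta> / 2 + min \<eta> (1/2) \<le> 1 - (1 - \<eta>) ^ 3"
  proof (cases "\<eta> \<le> 1/2")
    case True
    have "\<eta> * (3/2) \<le> \<eta> * (3 - 3 * \<eta> + \<eta>\<^sup>2)" using True assms zero_le_power2[of \<eta>] by (intro mult_left_mono) linarith+
    then show ?thesis unfolding cube using True by simp
  next
    case False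
    have "(1 - \<eta>)\<^sup>2 \<le> (1/2)\<^sup>2" using False assms by (intro power_mono) auto
    then have "(1 - \<eta>) * (1 - \<eta>)\<^sup>2 \<le> (1 - \<eta>) * (1/2)" using assms by (intro mult_left_mono) (auto simp: power2_eq_square)
    then have "(1 - \<eta>) ^ 3 \<le> (1 - \<eta>) * (1/2)" by (simp add: power3_eq_cube power2_eq_square)
    then show ?thesis using False by simp
  qed
  show "\<eta> / 4 + \<eta>\<^sup>2 / 16 + min \<eta> (1/2) \<le> 1 - (1 - \<eta>) ^ 3"
  proof (cases "\<eta> \<le> 1/2")
    case True
    have "\<eta> * (5/4 + \<eta> / 16) \<le> \<eta> * (3 - 3 * \<eta> + \<eta>\<^sup>2)"
      using True assms zero_le_power2[of \<eta>] by (intro mult_left_mono) linarith+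
    then show ?thesis unfolding cube using True by (simp add: algebra_simps power2_eq_square)
  next
    case False
    have "(1 - \<eta>) ^ 3 \<le> (1/2) ^ 3" using False assms by (intro power_mono) auto
    moreover have "\<eta>\<^sup>2 \<le> 1" using assms by (simp add: power_le_one)
    ultimately show ?thesis using False assms by (simp add: power3_eq_cube)
  qed
qed

section \<open>The union bound over the bad samples\<close>

lemma length_filter_eq_sum_list_indicator:
  "real (length (filter (\<lambda>x. x \<in> B) xs)) = (\<Sum>x\<leftarrow>xs. indicat_real B x)"
  by (induction xs) auto

text \<open>For \<open>k = 1\<close> the plain union bound would be (\<eta>/2)^(3/2) + \<eta>/2 +
  \<open>min \<eta> (1/2)\<close>, which exceeds 1 for \<eta> near 1. That case therefore merges
  cluster size and outlier count into one event; for \<open>k \<ge> 2\<close> the plain union bound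
  suffices.\<close>

lemma card_bad_samples_le:
  fixes C :: "nat \<Rightarrow> 'a set" and g :: "'a \<Rightarrow> real" and m k K :: nat and \<delta> \<eta> t R :: real
  assumes P: "finite P" and k: "1 \<le> k" and m: "0 < m"
    and QP: "(\<Union>j<k. C j) \<subset> P" and Q0: "(\<Union>j<k. C j) \<noteq> {}"
    and \<eta>: "0 < \<eta>" "\<eta> < 1" and \<delta>: "0 < \<delta>" "\<delta> < 1"
    and R: "0 \<le> R" and g: "\<And>x. x \<in> P \<Longrightarrow> 0 \<le> g x \<and> g x \<le> R"
    and lower: "\<And>j. j < k \<Longrightarrow>
      3/2 * ln (2 * real k / \<eta>) \<le> \<delta>\<^sup>2 * (real m / real (card P) * real (card (C j))) / 2"
    and upper: "real k * ln (2 * real k / \<eta>) \<le> \<delta> * t"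
    and K: "real m * (real (card (P - (\<Union>j<k. C j))) / real (card P)) / \<eta> \<le> real K"
  defines "bad1 \<equiv> (\<lambda>j. {S \<in> samples P m. (\<Sum>x\<leftarrow>S. indicat_real (C j) x)
            < (1 - \<delta>) * (real m / real (card P) * real (card (C j)))})"
    and "bad2 \<equiv> {S \<in> samples P m.
            (1 + \<delta>) * (real m / real (card P) * (\<Sum>x\<in>P. g x)) + R * t < (\<Sum>x\<leftarrow>S. g x)}"
    and "bad3 \<equiv> {S \<in> samples P m. K < length (filter (\<lambda>x. x \<in> P - (\<Union>j<k. C j)) S)}"
  shows "real (card ((\<Union>j<k. bad1 j) \<union> bad2 \<union> bad3)) \<le> real (card P) ^ m * (1 - (1 - \<eta>) ^ 3)"
proof -
  define T where "T = real (card P) ^ m"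
  define Q where "Q = (\<Union>j<k. C j)"
  define l where "l = ln (2 * real k / \<eta>)"
  have P0: "P \<noteq> {}" using QP by auto
  have T: "T > 0" using P P0 by (simp add: T_def card_gt_0_iff)
  have el: "exp (- l) = \<eta> / (2 * real k)"
    using \<eta> k by (simp add: l_def exp_minus)
  have l0: "l \<ge> 0" using \<eta> k by (simp add: l_def field_simps)
  have b1: "real (card (bad1 j)) \<le> T * exp (- (3/2 * l))" if "j < k" for j
  proof -
    have "C j \<subseteq> P" using QP that by auto
    then have "real (card (bad1 j)) \<le> T * exp (- (\<delta>\<^sup>2 * (real m / real (card P) * real (card (C j))) / 2))"
      unfolding bad1_def T_def using P P0 \<delta> by (intro card_samples_lower_tail)
    also have "\<dots> \<le> T * exp (- (3/2 * l))"
      using lower[OF that] T by (simp add: l_def)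
    finally show ?thesis .
  qed
  have b2: "real (card bad2) \<le> T * exp (- (real k * l))"
  proof -
    have "real (card bad2) \<le> T * exp (- (\<delta> * t))"
      unfolding bad2_def T_def using P P0 \<delta> R g by (intro card_samples_upper_tail)
    also have "\<dots> \<le> T * exp (- (real k * l))" using upper T by (simp add: l_def)
    finally show ?thesis .
  qed
  have b3: "real (card bad3) \<le> T * min \<eta> (1/2)"
  proof -
    define p where "p = real (card (P - Q)) / real (card P)"
    have "card (P - Q) > 0" using QP P by (auto simp: Q_def card_gt_0_iff)
    moreover have "card (P - Q) < card P" using QP P Q0 by (intro psubset_card_mono) (auto simp: Q_def)
    ultimately have p: "0 < p" "p < 1" by (auto simp: p_def)
    have K': "real m * p / \<eta> \<le> real K" using K by (simp add: p_def Q_def)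
    have "real m * p \<le> real m * p / \<eta>" using p \<eta> by (simp add: field_simps mult_left_le_one_le)
    then have "real m * p \<le> real K" using K' by simp
    then have "(\<Sum>i\<in>{K<..m}. Bernstein m i p) \<le> min \<eta> (1/2)"
      using binomial_upper_tail_le_half[OF p] binomial_upper_tail_Markov[OF p \<eta>(1) m K'] by simp
    moreover have "real (card bad3) = T * (\<Sum>i\<in>{K<..m}. Bernstein m i p)"
      unfolding bad3_def T_def p_def Q_def[symmetric] using P P0 by (intro card_samples_count_tail) auto
    ultimately show ?thesis using T by simp
  qed
  have un: "real (card (X \<union> Y)) \<le> real (card X) + real (card Y)" for X Y :: "'a list set"
    using card_Un_le[of X Y] by linarith
  show ?thesis
  proof (cases "k = 1")
    case True
    \<comment> \<open>A sample point outside the only cluster is an outlier, so both conditions bound the same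
      count from below and one of them implies the other.\<close>
    have U: "(\<Union>j<k. bad1 j) = bad1 0" using True by (auto simp: lessThan_Suc)
    have Q: "Q = C 0" using True by (auto simp: Q_def lessThan_Suc)
    have cnt: "real (length (filter (\<lambda>x. x \<in> P - Q) S)) = real m - (\<Sum>x\<leftarrow>S. indicat_real (C 0) x)"
      if "S \<in> samples P m" for S
    proof -
      have "filter (\<lambda>x. x \<in> P - Q) S = filter (\<lambda>x. \<not> x \<in> Q) S"
        using that by (intro filter_cong) (auto simp: samples_def)
      moreover have "real (length S) = real m" using that by (simp add: samples_def)
      ultimately show ?thesis
        using sum_length_filter_compl[of "\<lambda>x. x \<in> Q" S] length_filter_eq_sum_list_indicator[of Q S]
        by (simp flip: Q)
    qed
    have bad3': "bad3 = {S \<in> samples P m. (\<Sum>x\<leftarrow>S. indicat_real (C 0) x) < real m - real K}"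
      unfolding bad3_def Q_def[symmetric] using cnt by force
    have "bad1 0 \<subseteq> bad3 \<or> bad3 \<subseteq> bad1 0"
      unfolding bad3' bad1_def by force
    then have "bad1 0 \<union> bad3 = bad3 \<or> bad1 0 \<union> bad3 = bad1 0" by blast
    \<comment> \<open>Either of the nested events may be the larger one, so \<open>bad1 0\<close>
      needs the same bound as \<open>bad3\<close>.\<close>
    moreover have "real (card (bad1 0)) \<le> T * min \<eta> (1/2)"
    proof -
      have "exp (- (3/2 * l)) \<le> exp (- l)" using l0 by simp
      also have "\<dots> = \<eta> / 2" using el True by simp
      also have "\<dots> \<le> min \<eta> (1/2)" using \<eta> by simp
      finally have "T * exp (- (3/2 * l)) \<le> T * min \<eta> (1/2)" using T by (intro mult_left_mono) auto
      then show ?thesis using b1[of 0] k by simp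
    qed
    ultimately have "real (card (bad1 0 \<union> bad3)) \<le> T * min \<eta> (1/2)" using b3 by auto
    moreover have "real (card bad2) \<le> T * (\<eta> / 2)" using b2 True el by simp
    ultimately have "real (card (bad1 0 \<union> bad3 \<union> bad2)) \<le> T * (\<eta> / 2 + min \<eta> (1/2))"
      using un[of "bad1 0 \<union> bad3" bad2] by (simp add: distrib_left)
    also have "\<dots> \<le> T * (1 - (1 - \<eta>) ^ 3)"
      using T failure_budget_le(1)[OF \<eta>] by (intro mult_left_mono) auto
    finally show ?thesis unfolding U T_def[symmetric] by (simp add: Un_ac)
  next
    case False
    then have k2: "real k \<ge> 2" using k by simp
    have small: "\<eta> / (2 * real k) \<le> \<eta> / 4" using k2 \<eta> by (simp add: field_simps)
    \<comment> \<open>For \<open>k \<ge> 2\<close>, exp(-l) <= 1/4. The extra half power thus saves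
      a factor 2 per cluster, and the k clusters together cost \<eta>/4.\<close>
    have "(exp (- (l / 2)))\<^sup>2 = exp (- l)" by (simp add: power2_eq_square flip: exp_add)
    also have "\<dots> \<le> (1/2)\<^sup>2" unfolding el using small \<eta> by (simp add: power2_eq_square)
    finally have half: "exp (- (l / 2)) \<le> 1/2" by (rule power2_le_imp_le) simp
    have e32: "exp (- (3/2 * l)) \<le> \<eta> / (4 * real k)"
    proof -
      have "exp (- (3/2 * l)) = exp (- l) * exp (- (l / 2))" by (simp flip: exp_add)
      also have "\<dots> \<le> \<eta> / (2 * real k) * (1/2)"
        unfolding el using half \<eta> by (intro mult_left_mono) auto
      finally show ?thesis by simp
    qed
    have "real (card (\<Union>j<k. bad1 j)) \<le> (\<Sum>j<k. real (card (bad1 j)))"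
      using card_UN_le[of "{..<k}" bad1] by (simp flip: of_nat_sum)
    also have "\<dots> \<le> (\<Sum>j<k. T * (\<eta> / (4 * real k)))"
    proof (rule sum_mono)
      fix j assume "j \<in> {..<k}"
      then show "real (card (bad1 j)) \<le> T * (\<eta> / (4 * real k))"
        using b1[of j] mult_left_mono[OF e32, of T] T by simp
    qed
    also have "\<dots> = T * (\<eta> / 4)" using k by simp
    finally have B1: "real (card (\<Union>j<k. bad1 j)) \<le> T * (\<eta> / 4)" .
    have "exp (- (real k * l)) \<le> exp (- (2 * l))" using k2 l0 by (simp add: mult_right_mono)
    also have "\<dots> = (exp (- l))\<^sup>2" by (simp add: power2_eq_square flip: exp_add)
    also have "\<dots> \<le> (\<eta> / 4)\<^sup>2" unfolding el using small \<eta> by (intro power_mono) auto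
    finally have "T * exp (- (real k * l)) \<le> T * (\<eta>\<^sup>2 / 16)"
      using T by (simp add: power_divide)
    then have B2: "real (card bad2) \<le> T * (\<eta>\<^sup>2 / 16)" using b2 by simp
    have "real (card ((\<Union>j<k. bad1 j) \<union> bad2 \<union> bad3)) \<le> T * (\<eta> / 4 + \<eta>\<^sup>2 / 16 + min \<eta> (1/2))"
      using un[of "(\<Union>j<k. bad1 j) \<union> bad2" bad3] un[of "\<Union>j<k. bad1 j" bad2] B1 B2 b3
      by (simp add: distrib_left)
    also have "\<dots> \<le> T * (1 - (1 - \<eta>) ^ 3)"
      using T failure_budget_le(2)[OF \<eta>] by (intro mult_left_mono) auto
    finally show ?thesis unfolding T_def .
  qed
qed

subsection \<open>Clustering costs\<close>

lemma dist_set_le: "finite H \<Longrightarrow> q \<in> H \<Longrightarrow> dist_set p H \<le> dist p q"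
  unfolding dist_set_def by (intro Min_le) auto

lemma dist_set_attained:
  assumes "finite H" "H \<noteq> {}"
  obtains q where "q \<in> H" "dist_set p H = dist p q"
proof -
  have "dist_set p H \<in> dist p ` H"
    unfolding dist_set_def using assms by (intro Min_in) auto
  then show ?thesis using that by blast
qed

lemma dist_set_nonneg: "finite H \<Longrightarrow> H \<noteq> {} \<Longrightarrow> 0 \<le> dist_set p H"
  by (metis dist_set_attained zero_le_dist)

text \<open>The triangle inequality squared, using (a + b)^2 <= 2 a^2 + 2 b^2.\<close>

lemma dist_set_sq_le:
  assumes "finite H" "H \<noteq> {}"
  shows "(dist_set p H)\<^sup>2 \<le> 2 * (dist p q)\<^sup>2 + 2 * (dist_set q H)\<^sup>2"
proof -
  obtain r where r: "r \<in> H" "dist_set q H = dist q r" by (rule dist_set_attained[OF assms])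
  have "dist_set p H \<le> dist p q + dist_set q H"
    using dist_set_le[OF assms(1) r(1), of p] dist_triangle[of p r q] r(2) by simp
  then have "(dist_set p H)\<^sup>2 \<le> (dist p q + dist_set q H)\<^sup>2"
    using dist_set_nonneg[OF assms] by (intro power_mono)
  also have "\<dots> \<le> 2 * (dist p q)\<^sup>2 + 2 * (dist_set q H)\<^sup>2"
    using zero_le_power2[of "dist p q - dist_set q H"] by (simp add: power2_eq_square algebra_simps)
  finally show ?thesis .
qed

lemma sum_list_sum_swap:
  fixes f :: "'b \<Rightarrow> 'a \<Rightarrow> real"
  shows "(\<Sum>x\<leftarrow>xs. \<Sum>j\<in>J. f j x) = (\<Sum>j\<in>J. \<Sum>x\<leftarrow>xs. f j x)"
  by (induction xs) (auto simp: sum.distrib)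

text \<open>Each point of \<open>C j\<close> reaches \<open>H\<close> through \<open>ctr j\<close>,
  at the extra cost \<open>D j\<close>. In turn \<open>D j\<close> is bounded through every sample
  point in \<open>C j\<close>, and there are at least \<kappa> times \<open>card (C j)\<close> of
  these. The factor 2 from each passage gives 4/\<kappa>.\<close>

lemma cluster_cost_le_sample_cost:
  fixes C :: "nat \<Rightarrow> 'a::euclidean_space set" and ctr :: "nat \<Rightarrow> 'a" and \<kappa> :: real
  assumes H: "finite H" "H \<noteq> {}" and \<kappa>: "\<kappa> > 0"
    and disj: "\<forall>i<k. \<forall>j<k. i \<noteq> j \<longrightarrow> C i \<inter> C j = {}"
    and many: "\<And>j. j < k \<Longrightarrow> \<kappa> * real (card (C j)) \<le> (\<Sum>x\<leftarrow>S. indicat_real (C j) x)"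
  shows "(\<Sum>j<k. \<Sum>p\<in>C j. (dist_set p H)\<^sup>2) \<le> 2 * (\<Sum>j<k. \<Sum>p\<in>C j. (dist p (ctr j))\<^sup>2)
    + 4 / \<kappa> * ((\<Sum>x\<leftarrow>S. \<Sum>j<k. indicat_real (C j) x * (dist x (ctr j))\<^sup>2) + kmeans_cost S H)"
proof -
  define D where "D j = (dist_set (ctr j) H)\<^sup>2" for j
  define F where "F j x = indicat_real (C j) x * ((dist x (ctr j))\<^sup>2 + (dist_set x H)\<^sup>2)" for j x
  have D: "\<kappa> * (real (card (C j)) * D j) \<le> 2 * (\<Sum>x\<leftarrow>S. F j x)" if "j < k" for j
  proof -
    have "\<kappa> * (real (card (C j)) * D j) \<le> (\<Sum>x\<leftarrow>S. indicat_real (C j) x) * D j"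
      using mult_right_mono[OF many[OF that], of "D j"] by (simp add: D_def mult.assoc)
    also have "\<dots> = (\<Sum>x\<leftarrow>S. indicat_real (C j) x * D j)"
      by (induction S) (auto simp: algebra_simps)
    also have "\<dots> \<le> (\<Sum>x\<leftarrow>S. 2 * F j x)"
      using dist_set_sq_le[OF H, of "ctr j"]
      by (intro sum_list_mono) (auto simp: D_def F_def indicator_def dist_commute)
    also have "\<dots> = 2 * (\<Sum>x\<leftarrow>S. F j x)"
      by (induction S) (auto simp: algebra_simps)
    finally show ?thesis .
  qed
  have "(\<Sum>j<k. \<Sum>p\<in>C j. (dist_set p H)\<^sup>2)
      \<le> (\<Sum>j<k. \<Sum>p\<in>C j. 2 * (dist p (ctr j))\<^sup>2 + 2 * D j)"
    unfolding D_def by (intro sum_mono dist_set_sq_le H)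
  also have "\<dots> = 2 * (\<Sum>j<k. \<Sum>p\<in>C j. (dist p (ctr j))\<^sup>2) + 2 * (\<Sum>j<k. real (card (C j)) * D j)"
    by (simp add: sum.distrib sum_distrib_left mult_ac)
  also have "(\<Sum>j<k. real (card (C j)) * D j) \<le> 2 / \<kappa> * (\<Sum>j<k. \<Sum>x\<leftarrow>S. F j x)"
    unfolding sum_distrib_left using D \<kappa> by (intro sum_mono) (simp add: field_simps)
  also have "(\<Sum>j<k. \<Sum>x\<leftarrow>S. F j x) = (\<Sum>x\<leftarrow>S. \<Sum>j<k. F j x)"
    by (rule sum_list_sum_swap[symmetric])
  also have "\<dots> \<le> (\<Sum>x\<leftarrow>S. (\<Sum>j<k. indicat_real (C j) x * (dist x (ctr j))\<^sup>2) + (dist_set x H)\<^sup>2)"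
  proof (rule sum_list_mono)
    fix x
    \<comment> \<open>By disjointness a sample point lies in at most one cluster, so its distance to
      \<open>H\<close> is charged at most once.\<close>
    have "(\<Sum>j<k. indicat_real (C j) x) = (indicat_real (\<Union>j<k. C j) x)"
      using disj by (intro indicator_UN_disjoint[symmetric]) (auto simp: disjoint_family_on_def)
    then have "(\<Sum>j<k. indicat_real (C j) x) * (dist_set x H)\<^sup>2 \<le> 1 * (dist_set x H)\<^sup>2"
      by (intro mult_right_mono) (auto simp: indicator_def)
    then show "(\<Sum>j<k. F j x) \<le> (\<Sum>j<k. indicat_real (C j) x * (dist x (ctr j))\<^sup>2) + (dist_set x H)\<^sup>2"
      by (simp add: F_def distrib_left sum.distrib sum_distrib_right)
  qed
  also have "\<dots> = (\<Sum>x\<leftarrow>S. \<Sum>j<k. indicat_real (C j) x * (dist x (ctr j))\<^sup>2) + kmeans_cost S H"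
    by (simp add: kmeans_cost_def sum_list_addf)
  finally show ?thesis using \<kappa> by (simp add: mult_left_mono divide_right_mono)
qed

lemma kmeans_cost_c_approx_le:
  fixes H :: "'a::euclidean_space set"
  assumes approx: "is_c_approx c M S H" and c: "0 \<le> c" and A: "finite A" "card A \<le> M" "0 < M"
    and near: "\<And>q. q \<in> set S \<Longrightarrow> \<exists>a\<in>A. (dist q a)\<^sup>2 \<le> g q"
  shows "kmeans_cost S H \<le> c * (\<Sum>q\<leftarrow>S. g q)"
proof -
  have inf: "infinite (UNIV :: 'a set)"
    using finite_imp_not_open[of "UNIV :: 'a set"] by auto
  have "infinite (- A)" using inf A(1) by (metis finite_compl Compl_eq_Diff_UNIV)
  \<comment> \<open>The infimum ranges over sets of exactly \<open>M\<close> centers, so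
    \<open>A\<close> is padded with arbitrary further points; these cannot increase any
    distance.\<close>
  then obtain B where B: "B \<subseteq> - A" "finite B" "card B = M - card A"
    using infinite_arbitrarily_large by blast
  define H' where "H' = A \<union> B"
  have H': "finite H'" "card H' = M"
    using A B by (auto simp: H'_def card_Un_disjoint disjoint_eq_subset_Compl[symmetric] inf_commute)
  then have ne: "H' \<noteq> {}" using A by auto
  have nonneg: "0 \<le> kmeans_cost S X" for X :: "'a set"
    unfolding kmeans_cost_def by (intro sum_list_nonneg) auto
  have "(INF X\<in>{X. finite X \<and> card X = M}. kmeans_cost S X) \<le> kmeans_cost S H'"
    using H' nonneg by (intro cINF_lower) (auto intro!: bdd_belowI)
  also have "\<dots> \<le> (\<Sum>q\<leftarrow>S. g q)"
    unfolding kmeans_cost_def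
  proof (rule sum_list_mono)
    fix q assume "q \<in> set S"
    then obtain a where a: "a \<in> A" "(dist q a)\<^sup>2 \<le> g q" using near by blast
    have "dist_set q H' \<le> dist q a" using a H' by (intro dist_set_le) (auto simp: H'_def)
    then have "(dist_set q H')\<^sup>2 \<le> (dist q a)\<^sup>2" using dist_set_nonneg[OF H'(1) ne] by (intro power_mono)
    then show "(dist_set q H')\<^sup>2 \<le> g q" using a by simp
  qed
  finally show ?thesis
    using approx c unfolding is_c_approx_def by (meson mult_left_mono order_trans)
qed

lemma trimmed_cost_le:
  assumes "finite P" "P' \<subseteq> P" "card P' = card P - z"
  shows "trimmed_cost P z H \<le> (\<Sum>p\<in>P'. (dist_set p H)\<^sup>2) / real (card P')"
  unfolding trimmed_cost_def
proof (rule Min_le)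
  have "{(\<Sum>p\<in>P'. (dist_set p H)\<^sup>2) / real (card P') | P'. P' \<subseteq> P \<and> card P' = card P - z}
    \<subseteq> (\<lambda>P'. (\<Sum>p\<in>P'. (dist_set p H)\<^sup>2) / real (card P')) ` Pow P" by auto
  then show "finite {(\<Sum>p\<in>P'. (dist_set p H)\<^sup>2) / real (card P') | P'. P' \<subseteq> P \<and> card P' = card P - z}"
    using assms(1) by (meson finite_Pow_iff finite_imageI finite_subset)
qed (use assms in blast)

text \<open>Expanding around the mean, the cross term vanishes because the deviations sum to
  0.\<close>

lemma sum_dist_mean_point_le:
  fixes C :: "'a::euclidean_space set"
  assumes "finite C"
  shows "(\<Sum>p\<in>C. (dist p (mean_point C))\<^sup>2) \<le> (\<Sum>p\<in>C. (dist p a)\<^sup>2)"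
proof (cases "C = {}")
  case False
  define o' where "o' = mean_point C"
  have n: "real (card C) > 0" using False assms by (simp add: card_gt_0_iff)
  have zero: "(\<Sum>p\<in>C. p - o') = 0"
    using n by (simp add: sum_subtractf o'_def mean_point_def sum_constant_scaleR)
  have split: "(dist p a)\<^sup>2 = (dist p o')\<^sup>2 + (2 * ((p - o') \<bullet> (o' - a)) + (dist o' a)\<^sup>2)" for p
  proof -
    have e: "p - a = (p - o') + (o' - a)" by simp
    show ?thesis unfolding dist_norm e power2_norm_eq_inner
      by (simp add: inner_commute algebra_simps)
  qed
  have "(\<Sum>p\<in>C. (dist p a)\<^sup>2)
      = (\<Sum>p\<in>C. (dist p o')\<^sup>2 + (2 * ((p - o') \<bullet> (o' - a)) + (dist o' a)\<^sup>2))"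
    by (intro sum.cong refl split)
  also have "\<dots> = (\<Sum>p\<in>C. (dist p o')\<^sup>2)
      + (2 * ((\<Sum>p\<in>C. p - o') \<bullet> (o' - a)) + real (card C) * (dist o' a)\<^sup>2)"
    by (simp only: sum.distrib inner_sum_left sum_distrib_left sum_constant)
  finally show ?thesis unfolding zero by (simp add: o'_def)
qed simp

text \<open>The vector from the mean to \<open>p\<close> averages the vectors from points of
  \<open>C\<close>. This bounds the cost of an inlier by the squared diameter.\<close>

lemma dist_mean_point_le:
  fixes C :: "'a::euclidean_space set"
  assumes C: "finite C" "C \<noteq> {}" and L: "\<And>q. q \<in> C \<Longrightarrow> dist p q \<le> L"
  shows "dist p (mean_point C) \<le> L"
proof -
  have n: "real (card C) > 0" using C by (simp add: card_gt_0_iff)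
  have "p - mean_point C = (1 / real (card C)) *\<^sub>R (\<Sum>q\<in>C. p - q)"
    using n by (simp add: mean_point_def sum_subtractf sum_constant_scaleR scaleR_diff_right)
  then have "dist p (mean_point C) = (1 / real (card C)) * norm (\<Sum>q\<in>C. p - q)"
    by (simp add: dist_norm)
  also have "\<dots> \<le> (1 / real (card C)) * (\<Sum>q\<in>C. dist p q)"
    unfolding dist_norm by (intro mult_left_mono norm_sum) auto
  also have "\<dots> \<le> (1 / real (card C)) * (real (card C) * L)"
    using L n by (intro mult_left_mono sum_bounded_above) auto
  finally show ?thesis using n by simp
qed

subsection \<open>The approximation guarantee\<close>

theorem theorem3:
  fixes P :: "'a::euclidean_space set" and k z :: nat
    and \<epsilon>1 \<epsilon>2 \<eta> \<delta> \<xi> c :: real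
    and h :: "nat \<Rightarrow> 'a" and C :: "nat \<Rightarrow> 'a set" and Popt :: "'a set"
    and A :: "'a list \<Rightarrow> 'a set pmf"
  assumes finP: "finite P"
    and k_pos: "k \<ge> 1"
    and z_bounds: "0 < z" "z < card P"
    \<comment> \<open>an optimal solution (k centers h 0..h (k-1)) of k-means with z outliers\<close>
    and opt: "\<forall>H. finite H \<and> H \<noteq> {} \<and> card H \<le> k \<longrightarrow>
                 trimmed_cost P z (h ` {..<k}) \<le> trimmed_cost P z H"
    \<comment> \<open>its inlier set\<close>
    and Popt_sub: "Popt \<subseteq> P" and Popt_card: "card Popt = card P - z"
    and Popt_opt: "(\<Sum>p\<in>Popt. (dist_set p (h ` {..<k}))\<^sup>2) / real (card Popt)
                     = trimmed_cost P z (h ` {..<k})"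
    \<comment> \<open>the optimal clusters\<close>
    and C_union: "(\<Union>j<k. C j) = Popt"
    and C_disj: "\<forall>i<k. \<forall>j<k. i \<noteq> j \<longrightarrow> C i \<inter> C j = {}"
    and C_assign: "\<forall>j<k. \<forall>p\<in>C j. dist p (h j) = dist_set p (h ` {..<k})"
    \<comment> \<open>(epsilon1, epsilon2)-significance\<close>
    and eps_pos: "\<epsilon>1 > 0" "\<epsilon>2 > 0"
    and signif1: "\<forall>j<k. real (card (C j)) \<ge> \<epsilon>1 / real k * real (card P)"
    and signif2: "real z = \<epsilon>2 / real k * real (card P)"
    and params: "0 < \<eta>" "\<eta> < 1" "0 < \<delta>" "\<delta> < 1" "0 < \<xi>" "\<xi> < 1"
    and c_ge: "c \<ge> 1"
    \<comment> \<open>the c-approximation algorithm (possibly randomized)\<close>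
    and A_approx: "\<forall>S \<in> samples P
          (nat \<lceil>max (3 * real k / (\<delta>\<^sup>2 * \<epsilon>1) * ln (2 * real k / \<eta>))
                    (real k / (2 * \<xi>\<^sup>2 * \<epsilon>1 * (1 - \<delta>)) * ln (2 * real k / \<eta>))\<rceil>).
          \<forall>H \<in> set_pmf (A S). is_c_approx c (k + nat \<lceil>(1 / \<eta>) * (\<epsilon>2 / real k) * real (length S)\<rceil>) S H"
  shows "measure_pmf.prob
           (bind_pmf (pmf_of_set (samples P
              (nat \<lceil>max (3 * real k / (\<delta>\<^sup>2 * \<epsilon>1) * ln (2 * real k / \<eta>))
                        (real k / (2 * \<xi>\<^sup>2 * \<epsilon>1 * (1 - \<delta>)) * ln (2 * real k / \<eta>))\<rceil>))) A)
           {H. trimmed_cost P z H \<le>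
                 (2 + (4 + 4 * c) * (1 + \<delta>) / (1 - \<delta>)) * trimmed_cost P z (mean_point ` C ` {..<k})
                 + ((4 + 4 * c) * (1 + \<delta>) / (1 - \<delta>)) * \<xi> * (max_diam k C)\<^sup>2}
         \<ge> (1 - \<eta>) ^ 3"
proof -
  define m where "m = nat \<lceil>max (3 * real k / (\<delta>\<^sup>2 * \<epsilon>1) * ln (2 * real k / \<eta>))
                    (real k / (2 * \<xi>\<^sup>2 * \<epsilon>1 * (1 - \<delta>)) * ln (2 * real k / \<eta>))\<rceil>"
  define n where "n = real (card P)"
  define l where "l = ln (2 * real k / \<eta>)"
  define K where "K = nat \<lceil>(1 / \<eta>) * (\<epsilon>2 / real k) * real m\<rceil>"
  define ctr where "ctr j = mean_point (C j)" for j
  define L where "L = max_diam k C"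
  \<comment> \<open>Outliers are charged 0, since sampled outliers become centers
    themselves.\<close>
  define g where "g x = (\<Sum>j<k. indicat_real (C j) x * (dist x (ctr j))\<^sup>2)" for x
  define G where "G = (\<Sum>j<k. \<Sum>p\<in>C j. (dist p (ctr j))\<^sup>2)"
  define N where "N = real (card Popt)"
  \<comment> \<open>Chosen so that the slack \<open>L\<^sup>2 * t\<close> has the same factor (1 +
    \<delta>) m/n as the mean term and leaves \<xi> L^2 per inlier.\<close>
  define t where "t = (1 + \<delta>) * (real m / n * N * \<xi>)"

  \<comment> \<open>Consequences of significance and of the sample size\<close>
  have n: "n > 0" using z_bounds by (simp add: n_def)
  have P0: "P \<noteq> {}" using z_bounds by auto
  have N: "N > 0" using Popt_card z_bounds by (simp add: N_def)
  have k: "real k \<ge> 1" using k_pos by simp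
  have l: "l > 0" using k params unfolding l_def by (intro ln_gt_zero) (simp add: field_simps)
  have C_sub: "C j \<subseteq> Popt" if "j < k" for j using C_union that by auto
  have C_fin: "finite (C j)" if "j < k" for j
    using C_sub[OF that] Popt_sub finP by (meson finite_subset)
  have C_card: "real (card (C j)) \<ge> \<epsilon>1 / real k * n" if "j < k" for j
    using signif1 that by (simp add: n_def)
  have C_pos: "real (card (C j)) > 0" if "j < k" for j
  proof -
    have "\<epsilon>1 / real k * n > 0" using eps_pos n k by simp
    then show ?thesis using C_card[OF that] by linarith
  qed
  have C_ne: "C j \<noteq> {}" if "j < k" for j using C_pos[OF that] by auto
  have N_ge: "N \<ge> \<epsilon>1 * n"
  proof -
    have "card Popt = (\<Sum>j<k. card (C j))"
      unfolding C_union[symmetric] using C_fin C_disj by (intro card_UN_disjoint) auto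
    then have "N = (\<Sum>j<k. real (card (C j)))" by (simp add: N_def)
    also have "\<dots> \<ge> (\<Sum>j<k. \<epsilon>1 / real k * n)" using C_card by (intro sum_mono) auto
    finally show ?thesis using k by simp
  qed
  have m1: "3 * real k / (\<delta>\<^sup>2 * \<epsilon>1) * l \<le> real m"
    and m2: "real k / (2 * \<xi>\<^sup>2 * \<epsilon>1 * (1 - \<delta>)) * l \<le> real m"
    unfolding m_def l_def by linarith+
  have m1': "3 * real k * l \<le> \<delta>\<^sup>2 * \<epsilon>1 * real m"
    using m1 params eps_pos by (simp add: field_simps)
  have m2': "real k * l \<le> 2 * \<xi>\<^sup>2 * \<epsilon>1 * real m"
  proof -
    have "real k * l \<le> 2 * \<xi>\<^sup>2 * \<epsilon>1 * real m * (1 - \<delta>)"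
      using m2 params eps_pos by (simp add: field_simps)
    also have "\<dots> \<le> 2 * \<xi>\<^sup>2 * \<epsilon>1 * real m"
      using params eps_pos by (intro mult_left_le) auto
    finally show ?thesis .
  qed
  have m0: "m > 0"
  proof (rule ccontr)
    assume "\<not> m > 0"
    then have "real k * l \<le> 0" using m1' by (simp add: mult.commute)
    then show False using k l by (simp add: mult_le_0_iff)
  qed
  have lower: "3/2 * ln (2 * real k / \<eta>) \<le> \<delta>\<^sup>2 * (real m / real (card P) * real (card (C j))) / 2"
    if "j < k" for j
  proof -
    have "3 * l \<le> \<delta>\<^sup>2 * (real m / n * (\<epsilon>1 / real k * n))"
      using m1' k n by (simp add: field_simps)
    also have "\<dots> \<le> \<delta>\<^sup>2 * (real m / n * real (card (C j)))"
      using C_card[OF that] n by (intro mult_left_mono) auto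
    finally show ?thesis by (simp add: l_def n_def)
  qed
  have upper: "real k * ln (2 * real k / \<eta>) \<le> \<delta> * t"
  proof -
    \<comment> \<open>The two lower bounds on \<open>m\<close> have \<delta>^2 and \<xi>^2 where
      \<delta>\<xi> is wanted. If \<delta> <= 3\<xi>, the first suffices thanks to its factor 3;
      otherwise 2\<xi> <= \<delta> and the second does.\<close>
    have "real k * l \<le> \<delta> * \<xi> * (\<epsilon>1 * real m)"
    proof (cases "\<delta> \<le> 3 * \<xi>")
      case True
      have "\<delta>\<^sup>2 * (\<epsilon>1 * real m) \<le> \<delta> * (3 * \<xi>) * (\<epsilon>1 * real m)"
        unfolding power2_eq_square using True params eps_pos by (intro mult_right_mono mult_left_mono) auto
      then show ?thesis using m1' by (simp add: mult_ac)
    next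
      case False
      have "2 * \<xi>\<^sup>2 * (\<epsilon>1 * real m) \<le> \<delta> * \<xi> * (\<epsilon>1 * real m)"
        unfolding power2_eq_square mult.assoc[symmetric]
        using False params eps_pos by (intro mult_right_mono) auto
      then show ?thesis using m2' by (simp add: mult_ac)
    qed
    also have "\<dots> = \<delta> * (real m / n * (\<epsilon>1 * n) * \<xi>)" using n by simp
    also have "\<dots> \<le> \<delta> * (real m / n * N * \<xi>)"
      using N_ge params n by (intro mult_left_mono mult_right_mono) auto
    also have "\<dots> \<le> \<delta> * t"
      unfolding t_def using params n N by (intro mult_left_mono) (auto simp: distrib_right divide_right_mono)
    finally show ?thesis by (simp add: l_def)
  qed

  \<comment> \<open>Inlier costs with respect to the cluster means\<close>
  have L: "dist p q \<le> L" if "j < k" "p \<in> C j" "q \<in> C j" for j p q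
    unfolding L_def max_diam_def
  proof (rule Max_ge)
    have "{dist p q |p q. p \<in> C j \<and> q \<in> C j} = case_prod dist ` (C j \<times> C j)" for j by auto
    then show "finite (\<Union>j<k. {dist p q |p q. p \<in> C j \<and> q \<in> C j})" using C_fin by auto
  qed (use that in auto)
  have g_in: "g x = (dist x (ctr j))\<^sup>2" if "j < k" "x \<in> C j" for x j
  proof -
    have "g x = (\<Sum>i<k. if i = j then (dist x (ctr j))\<^sup>2 else 0)"
      unfolding g_def using that C_disj by (intro sum.cong) (auto simp: indicator_def)
    then show ?thesis using that by simp
  qed
  have g_out: "g x = 0" if "x \<notin> Popt" for x
    using that C_union unfolding g_def by (intro sum.neutral) (auto simp: indicator_def)
  have g_bounds: "0 \<le> g x \<and> g x \<le> L\<^sup>2" for x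
  proof (cases "x \<in> Popt")
    case True
    then obtain j where j: "j < k" "x \<in> C j" using C_union by auto
    have "dist x (ctr j) \<le> L"
      unfolding ctr_def using j L C_fin C_ne by (intro dist_mean_point_le) auto
    then show ?thesis using g_in[OF j] by (simp add: power_mono)
  qed (simp add: g_out)
  have Popt_sum: "(\<Sum>p\<in>Popt. f p) = (\<Sum>j<k. \<Sum>p\<in>C j. f p)" for f :: "'a \<Rightarrow> real"
    unfolding C_union[symmetric] using C_fin C_disj by (intro sum.UNION_disjoint) auto
  have g_sum: "(\<Sum>x\<in>P. g x) = G"
  proof -
    have "(\<Sum>x\<in>P. g x) = (\<Sum>x\<in>Popt. g x)"
      using finP Popt_sub g_out by (intro sum.mono_neutral_right) auto
    also have "\<dots> = G" unfolding Popt_sum G_def using g_in by (intro sum.cong) auto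
    finally show ?thesis .
  qed
  \<comment> \<open>The trimmed cost of the means may select other inliers than \<open>Popt\<close>,
    so the comparison goes through the optimal centers \<open>h\<close>: means improve on them
    cluster by cluster, and optimality of \<open>h\<close> covers the at most \<open>k\<close>
    distinct means.\<close>
  have G_le: "G / N \<le> trimmed_cost P z (mean_point ` C ` {..<k})"
  proof -
    have "G \<le> (\<Sum>j<k. \<Sum>p\<in>C j. (dist p (h j))\<^sup>2)"
      unfolding G_def ctr_def using C_fin by (intro sum_mono sum_dist_mean_point_le) auto
    also have "\<dots> = (\<Sum>p\<in>Popt. (dist_set p (h ` {..<k}))\<^sup>2)"
      unfolding Popt_sum using C_assign by (intro sum.cong) auto
    finally have "G / N \<le> (\<Sum>p\<in>Popt. (dist_set p (h ` {..<k}))\<^sup>2) / N"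
      using N by (intro divide_right_mono) auto
    also have "\<dots> = trimmed_cost P z (h ` {..<k})" using Popt_opt by (simp add: N_def)
    also have "\<dots> \<le> trimmed_cost P z (mean_point ` C ` {..<k})"
    proof -
      have "card (mean_point ` C ` {..<k}) \<le> k"
        using card_image_le[of "{..<k}" "mean_point \<circ> C"] by (simp add: image_comp)
      moreover have "{..<k} \<noteq> {}" using k_pos by (simp add: lessThan_empty_iff)
      ultimately show ?thesis using opt by simp
    qed
    finally show ?thesis .
  qed

  \<comment> \<open>The bad samples and their number\<close>
  define bad1 where "bad1 j = {S \<in> samples P m. (\<Sum>x\<leftarrow>S. indicat_real (C j) x)
      < (1 - \<delta>) * (real m / real (card P) * real (card (C j)))}" for j
  define bad2 where "bad2 = {S \<in> samples P m.
      (1 + \<delta>) * (real m / real (card P) * (\<Sum>x\<in>P. g x)) + L\<^sup>2 * t < (\<Sum>x\<leftarrow>S. g x)}"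
  define bad3 where "bad3 = {S \<in> samples P m. K < length (filter (\<lambda>x. x \<in> P - (\<Union>j<k. C j)) S)}"
  define bad where "bad = (\<Union>j<k. bad1 j) \<union> bad2 \<union> bad3"
  have bad_card: "real (card bad) \<le> real (card P) ^ m * (1 - (1 - \<eta>) ^ 3)"
    unfolding bad_def bad1_def bad2_def bad3_def
  proof (rule card_bad_samples_le[OF finP k_pos m0])
    have "Popt \<noteq> P" using Popt_card z_bounds by auto
    then show "(\<Union>j<k. C j) \<subset> P" using C_union Popt_sub by auto
    show "(\<Union>j<k. C j) \<noteq> {}" using N unfolding C_union N_def by auto
    have "card (P - Popt) = z"
      using Popt_card Popt_sub finP z_bounds by (simp add: card_Diff_subset finite_subset)
    then have "real m * (real (card (P - Popt)) / real (card P)) / \<eta> = (1 / \<eta>) * (\<epsilon>2 / real k) * real m"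
      using signif2 n by (simp add: n_def mult_ac)
    also have "\<dots> \<le> real K" unfolding K_def by linarith
    finally show "real m * (real (card (P - (\<Union>j<k. C j))) / real (card P)) / \<eta> \<le> real K"
      unfolding C_union .
  qed (use params lower upper g_bounds in auto)

  \<comment> \<open>The guarantee for a good sample\<close>
  define E where "E = {H. trimmed_cost P z H \<le>
                 (2 + (4 + 4 * c) * (1 + \<delta>) / (1 - \<delta>)) * trimmed_cost P z (mean_point ` C ` {..<k})
                 + ((4 + 4 * c) * (1 + \<delta>) / (1 - \<delta>)) * \<xi> * (max_diam k C)\<^sup>2}"
  have good: "H \<in> E" if S: "S \<in> samples P m" "S \<notin> bad" and HS: "H \<in> set_pmf (A S)" for S H
  proof -
    have len: "length S = m" and SP: "set S \<subseteq> P" using S by (auto simp: samples_def)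
    have approx: "is_c_approx c (k + K) S H"
      using A_approx HS S(1) len unfolding m_def[symmetric] K_def by auto
    have H: "finite H" "H \<noteq> {}"
      using approx k_pos by (auto simp: is_c_approx_def)
    define Y where "Y = (\<Sum>x\<leftarrow>S. g x)"
    have Y: "Y \<le> (1 + \<delta>) * (real m / n * G) + L\<^sup>2 * t"
      using S unfolding bad_def bad2_def g_sum Y_def n_def by auto
    have many: "(1 - \<delta>) * (real m / n) * real (card (C j)) \<le> (\<Sum>x\<leftarrow>S. indicat_real (C j) x)" if "j < k" for j
      using S that unfolding bad_def bad1_def n_def by (force simp: mult.assoc)
    have few: "length (filter (\<lambda>x. x \<in> P - Popt) S) \<le> K"
      using S unfolding bad_def bad3_def C_union by auto
    have cost: "kmeans_cost S H \<le> c * Y"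
      unfolding Y_def
    proof (rule kmeans_cost_c_approx_le[OF approx])
      let ?A = "ctr ` {..<k} \<union> set (filter (\<lambda>x. x \<in> P - Popt) S)"
      show "finite ?A" by simp
      have "card ?A \<le> card (ctr ` {..<k}) + card (set (filter (\<lambda>x. x \<in> P - Popt) S))"
        by (rule card_Un_le)
      also have "\<dots> \<le> k + K"
        using card_image_le[of "{..<k}" ctr] card_length[of "filter (\<lambda>x. x \<in> P - Popt) S"] few
        by (intro add_mono) auto
      finally show "card ?A \<le> k + K" .
      fix q assume q: "q \<in> set S"
      show "\<exists>a\<in>?A. (dist q a)\<^sup>2 \<le> g q"
      proof (cases "q \<in> Popt")
        case True
        then obtain j where "j < k" "q \<in> C j" using C_union by auto
        then show ?thesis using g_in by (intro bexI[of _ "ctr j"]) auto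
      next
        case False
        then show ?thesis using q SP g_bounds by (intro bexI[of _ q]) auto
      qed
    qed (use c_ge k_pos in auto)
    define \<kappa> where "\<kappa> = (1 - \<delta>) * (real m / n)"
    have \<kappa>: "\<kappa> > 0" using params m0 n by (simp add: \<kappa>_def)
    define \<beta> where "\<beta> = (4 + 4 * c) * (1 + \<delta>) / (1 - \<delta>)"
    have \<beta>: "\<beta> \<ge> 0" using params c_ge by (simp add: \<beta>_def)
    have "(\<Sum>p\<in>Popt. (dist_set p H)\<^sup>2) \<le> 2 * G + 4 / \<kappa> * (Y + kmeans_cost S H)"
      unfolding Popt_sum G_def Y_def g_def
      using many by (intro cluster_cost_le_sample_cost[OF H \<kappa> C_disj]) (simp add: \<kappa>_def)
    also have "\<dots> \<le> 2 * G + 4 / \<kappa> * ((1 + c) * Y)"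
      using cost \<kappa> by (intro add_left_mono mult_left_mono) (auto simp: algebra_simps)
    also have "\<dots> \<le> 2 * G + 4 / \<kappa> * ((1 + c) * ((1 + \<delta>) * (real m / n * G) + L\<^sup>2 * t))"
      using Y \<kappa> c_ge by (intro add_left_mono mult_left_mono) auto
    \<comment> \<open>The sampling rate m/n in \<kappa> cancels against the one in the bound on
      \<open>Y\<close>, leaving \<beta>.\<close>
    also have "\<dots> = 2 * G + \<beta> * (G + N * \<xi> * L\<^sup>2)"
    proof -
      have "(1 + \<delta>) * (real m / n * G) + L\<^sup>2 * t = (real m / n) * ((1 + \<delta>) * (G + N * \<xi> * L\<^sup>2))"
        by (simp add: t_def algebra_simps add_divide_distrib)
      moreover have "4 / \<kappa> * ((1 + c) * ((real m / n) * W)) = (4 + 4 * c) / (1 - \<delta>) * W" for W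
        unfolding \<kappa>_def using m0 n params by (simp add: field_simps)
      ultimately show ?thesis by (simp add: \<beta>_def)
    qed
    finally have "(\<Sum>p\<in>Popt. (dist_set p H)\<^sup>2) / N \<le> (2 * G + \<beta> * (G + N * \<xi> * L\<^sup>2)) / N"
      using N by (intro divide_right_mono) auto
    also have "\<dots> = (2 + \<beta>) * (G / N) + \<beta> * \<xi> * L\<^sup>2"
      using N by (simp add: field_simps)
    also have "\<dots> \<le> (2 + \<beta>) * trimmed_cost P z (mean_point ` C ` {..<k}) + \<beta> * \<xi> * L\<^sup>2"
      using G_le \<beta> by (intro add_right_mono mult_left_mono) auto
    \<comment> \<open>\<open>Popt\<close> is one of the sets over which the trimmed cost of
      \<open>H\<close> is minimized.\<close>
    finally have "trimmed_cost P z H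
        \<le> (2 + \<beta>) * trimmed_cost P z (mean_point ` C ` {..<k}) + \<beta> * \<xi> * L\<^sup>2"
      using trimmed_cost_le[OF finP Popt_sub Popt_card, of H] by (simp add: N_def)
    then show ?thesis by (simp add: E_def \<beta>_def L_def)
  qed

  \<comment> \<open>From counts to probabilities\<close>
  have fin: "finite (samples P m)" using finP by (rule finite_samples)
  have T: "real (card (samples P m)) = real (card P) ^ m" using card_samples[OF finP] by simp
  have T0: "real (card P) ^ m > 0" using n by (simp add: n_def)
  have ne: "samples P m \<noteq> {}" using T T0 by auto
  have bad_sub: "bad \<subseteq> samples P m" by (auto simp: bad_def bad1_def bad2_def bad3_def)
  have "real (card (samples P m - bad)) = real (card P) ^ m - real (card bad)"
    using bad_sub fin T card_mono[OF fin bad_sub]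
    by (simp add: card_Diff_subset finite_subset of_nat_diff)
  then have "real (card (samples P m - bad)) \<ge> real (card P) ^ m * (1 - \<eta>) ^ 3"
    using bad_card by (simp add: algebra_simps)
  then have "(1 - \<eta>) ^ 3 \<le> real (card (samples P m - bad)) / real (card P) ^ m"
    using T0 by (simp add: field_simps)
  also have "\<dots> = measure_pmf.prob (pmf_of_set (samples P m)) (samples P m - bad)"
    using ne fin T by (simp add: measure_pmf_of_set Int_absorb1)
  also have "\<dots> \<le> measure_pmf.prob (bind_pmf (pmf_of_set (samples P m)) A) E"
    using good by (intro prob_bind_pmf_ge) auto
  finally show ?thesis unfolding E_def m_def .
qed

end
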